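(* Let $n\ge1$ and $l_0\in M_n(\mathbb C)$. The orthogonal projection of $l_0$ onto $\mathfrak{su}(n)=\{A\in M_n(\mathbb C):A^\dagger=-A,\ \mathrm{tr}\,A=0\}$ is $$\mathrm{proj}_{\mathfrak{su}(n)}(l_0)=\tfrac12(l_0-l_0^\dagger)-\tfrac1{2n}\mathrm{tr}(l_0-l_0^\dagger)\,I.$$
   Context: Orthogonality is with respect to the real Frobenius inner product $\langle A,B\rangle=\mathrm{Re}\,\mathrm{tr}(A^\dagger B)$ on $M_n(\mathbb C)$ viewed as a real vector space; $A^\dagger$ is the conjugate transpose. The orthogonal projection of $l_0$ onto a real subspace $\mathfrak g$ is the element $P\in\mathfrak g$ with $\langle l_0-P,Y\rangle=0$ for all $Y\in\mathfrak g$. *)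

theory Defs
  imports "HOL-Analysis.Analysis"
begin

definition conj_transpose :: "complex^'n^'m \<Rightarrow> complex^'m^'n" where
  "conj_transpose A = map_matrix cnj (transpose A)"

definition frob_inner :: "complex^'n^'n \<Rightarrow> complex^'n^'n \<Rightarrow> real" where
  "frob_inner A B = Re (trace (conj_transpose A ** B))"

definition su :: "(complex^'n^'n) set" where
  "su = {A. conj_transpose A = - A \<and> trace A = 0}"

lemma subspace_su: "subspace su"
  by (auto simp: subspace_def su_def conj_transpose_def transpose_def map_matrix_def
      trace_def vec_eq_iff sum.distrib scaleR_sum_right [symmetric])

definition is_orth_proj :: "(complex^'n^'n) set \<Rightarrow> complex^'n^'n \<Rightarrow> complex^'n^'n \<Rightarrow> bool" where
  "is_orth_proj G L P \<longleftrightarrow> P \<in> G \<and> (\<forall>Y\<in>G. frob_inner (L - P) Y = 0)"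

(* Meaningful only where exactly one P satisfies is_orth_proj G L P. *)
definition orth_proj :: "(complex^'n^'n) set \<Rightarrow> complex^'n^'n \<Rightarrow> complex^'n^'n" where
  "orth_proj G L = (THE P. is_orth_proj G L P)"

end

theory Submission
  imports Defs
begin

text \<open>
  Decompose \<open>l0 = P + (H + c I)\<close>, where \<open>P\<close> is the claimed projection,
  \<open>H = (l0 + l0\<^sup>\<dagger>) / 2\<close> is Hermitian and \<open>c = tr (l0 - l0\<^sup>\<dagger>) / (2 n)\<close>.
  The number \<open>c\<close> is purely imaginary, so \<open>P\<close> is still skew-Hermitian after \<open>c I\<close> has been
  subtracted, and its value is the one that makes \<open>P\<close> traceless. The remainder \<open>H + c I\<close>
  is orthogonal to every \<open>Y\<close> in \<open>su(n)\<close>: the Hermitian part pairs to zero with the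
  skew-Hermitian \<open>Y\<close> (lemma \<open>inner_hermitian_skew\<close>), and \<open>c I\<close> pairs to zero with the
  traceless \<open>Y\<close> (lemma \<open>inner_mat_traceless\<close>).

  Uniqueness comes from positive definiteness: the Frobenius form is the standard real
  inner product of the coordinates (lemma \<open>frob_inner_eq_inner\<close>), so two projections onto a
  subspace differ by an element of that subspace that is orthogonal to itself.
\<close>

lemma conj_transpose_nth [simp]: "conj_transpose A $ i $ j = cnj (A $ j $ i)"
  by (simp add: conj_transpose_def map_matrix_def transpose_def)

lemma trace_conj_transpose: "trace (conj_transpose A) = cnj (trace A)"
  by (simp add: trace_def)

text \<open>
  The diagonal entries of \<open>A\<^sup>\<dagger> B\<close> run over the columns, whereas the library inner product
  sums over the rows, so the two double sums agree after a change in the order of summation.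
\<close>
lemma frob_inner_eq_inner: "frob_inner A B = A \<bullet> B"
proof -
  have "frob_inner A B = (\<Sum>i\<in>UNIV. \<Sum>k\<in>UNIV. Re (cnj (A $ k $ i) * B $ k $ i))"
    by (simp add: frob_inner_def trace_def matrix_matrix_mult_def)
  also have "\<dots> = (\<Sum>k\<in>UNIV. \<Sum>i\<in>UNIV. Re (cnj (A $ k $ i) * B $ k $ i))"
    by (rule sum.swap)
  also have "\<dots> = A \<bullet> B"
    by (simp add: inner_vec_def inner_complex_def)
  finally show ?thesis .
qed

lemma is_orth_proj_unique:
  assumes "subspace G" "is_orth_proj G L P" "is_orth_proj G L Q"
  shows "P = Q"
proof -
  have "P - Q \<in> G"
    using assms by (simp add: is_orth_proj_def subspace_diff)
  then have "(L - P) \<bullet> (P - Q) = 0" "(L - Q) \<bullet> (P - Q) = 0"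
    using assms(2,3) by (simp_all add: is_orth_proj_def frob_inner_eq_inner)
  then have "(P - Q) \<bullet> (P - Q) = 0"
    by (simp add: inner_diff_left)
  then show ?thesis by simp
qed

text \<open>
  Conjugation is an isometry of the complex plane and transposition only permutes the entries.
  Since the operation fixes Hermitian matrices and negates skew-Hermitian ones, the invariance
  forces the pairing of the two kinds to equal its own negative.
\<close>
lemma inner_conj_transpose: "conj_transpose A \<bullet> conj_transpose B = A \<bullet> B"
proof -
  have "conj_transpose A \<bullet> conj_transpose B = (\<Sum>i\<in>UNIV. \<Sum>j\<in>UNIV. A $ j $ i \<bullet> B $ j $ i)"
    by (simp add: inner_vec_def inner_complex_def)
  also have "\<dots> = (\<Sum>j\<in>UNIV. \<Sum>i\<in>UNIV. A $ j $ i \<bullet> B $ j $ i)"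
    by (rule sum.swap)
  also have "\<dots> = A \<bullet> B"
    by (simp add: inner_vec_def)
  finally show ?thesis .
qed

lemma inner_hermitian_skew:
  assumes "conj_transpose H = H" "conj_transpose Y = - Y"
  shows "H \<bullet> Y = 0"
  using inner_conj_transpose[of H Y] assms by simp

lemma inner_mat_traceless:
  fixes Y :: "complex^'n^'n"
  assumes "trace Y = 0"
  shows "mat c \<bullet> Y = 0"
proof -
  have "mat c \<bullet> Y = (\<Sum>i\<in>UNIV. \<Sum>j\<in>UNIV. if i = j then c \<bullet> Y $ i $ i else 0)"
    unfolding inner_vec_def by (intro sum.cong) (simp_all add: mat_def)
  also have "\<dots> = c \<bullet> trace Y"
    by (simp add: trace_def inner_sum_right)
  finally show ?thesis using assms by simp
qed

lemma is_orth_proj_su: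
  fixes L :: "complex^'n^'n"
  shows "is_orth_proj su L
    ((1 / 2) *\<^sub>R (L - conj_transpose L)
      - mat (trace (L - conj_transpose L) / (2 * of_nat CARD('n))))"
    (is "is_orth_proj su L ?P")
proof -
  define c where "c = trace (L - conj_transpose L) / (2 * of_nat CARD('n))"
  define H where "H = (1 / 2) *\<^sub>R (L + conj_transpose L)"
  have P: "?P = (1 / 2) *\<^sub>R (L - conj_transpose L) - mat c"
    by (simp add: c_def)
  have "cnj c = - c"
    by (simp add: c_def trace_sub trace_conj_transpose minus_divide_left)
  then have "conj_transpose ?P = - ?P"
    unfolding P by (simp add: vec_eq_iff mat_def scaleR_diff_right)
  moreover have "trace ?P = 0"
  proof -
    have "trace ?P = (1 / 2) *\<^sub>R trace (L - conj_transpose L) - of_nat CARD('n) * c"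
      unfolding P by (simp add: trace_def sum_subtractf scaleR_sum_right mat_def scaleR_diff_right)
    then show ?thesis by (simp add: c_def scaleR_conv_of_real)
  qed
  moreover have "frob_inner (L - ?P) Y = 0" if "Y \<in> su" for Y
  proof -
    have "L - ?P = H + mat c"
      unfolding P H_def by (simp add: vec_eq_iff complex_eq_iff field_simps)
    moreover have "conj_transpose H = H"
      by (simp add: H_def vec_eq_iff add.commute)
    ultimately show ?thesis
      using that inner_hermitian_skew[of H Y] inner_mat_traceless[of Y c]
      by (simp add: su_def frob_inner_eq_inner inner_add_left)
  qed
  ultimately show ?thesis
    by (simp add: is_orth_proj_def su_def)
qed

theorem mainTheorem6:
  fixes l0 :: "complex^'n^'n"
  shows "(\<exists>!P. is_orth_proj su l0 P) \<and>
    orth_proj su l0 =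
      (1 / 2) *\<^sub>R (l0 - conj_transpose l0)
      - mat (trace (l0 - conj_transpose l0) / (2 * of_nat CARD('n)))"
proof
  show ex1: "\<exists>!P. is_orth_proj su l0 P"
    using is_orth_proj_su is_orth_proj_unique[OF subspace_su] by blast
  show "orth_proj su l0 =
      (1 / 2) *\<^sub>R (l0 - conj_transpose l0)
      - mat (trace (l0 - conj_transpose l0) / (2 * of_nat CARD('n)))"
    unfolding orth_proj_def by (rule the1_equality[OF ex1 is_orth_proj_su])
qed

end
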